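(* Let $I$ be an ideal. Then for every principal ideal $(\xi)$ there is a principal ideal $(\zeta)\not\subset(\xi)$ with ${}_a(\zeta)\subset{}_aI$.
   Context: $H$ is a separable infinite-dimensional complex Hilbert space. "Ideal" means a two-sided ideal of $B(H)$ contained in the compact operators. $c_o^*$ is the set of nonnegative monotone nonincreasing sequences converging to $0$. $\Sigma(I):=\{s(X)\mid X\in I\}\subset c_o^*$, where $s(X)$ is the sequence of s-numbers (singular values) of $X$; an ideal is determined by $\Sigma(I)$. For $\xi\in c_o^*$, $(\xi)$ is the principal ideal generated by $\mathrm{diag}\,\xi$; every principal ideal has this form, and $\eta\in\Sigma((\xi))$ iff $\eta=O(D_m\xi)$ for some $m\in\mathbb N$, where $(D_m\xi)_n:=\xi_{\lceil n/m\rceil}$. For $\xi\in c_o^*$ put $(\xi_a)_n:=\frac1n\sum_{j=1}^n\xi_j$; the pre-arithmetic mean ${}_aI$ of an ideal $I$ is the ideal with $\Sigma({}_aI)=\{\xi\in c_o^*\mid\xi_a\in\Sigma(I)\}$ (possibly $\{0\}$). *)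

theory Defs
  imports "HOL-Analysis.Analysis"
begin

section \<open>Complex Hilbert spaces\<close>

text \<open>The complex inner product is linear in its second argument. The underlying real
  inner product is its real part, so norm and topology are those of \<^class>\<open>real_inner\<close>.\<close>

class complex_inner = real_inner +
  fixes scaleC :: "complex \<Rightarrow> 'a \<Rightarrow> 'a" (infixr \<open>*\<^sub>C\<close> 75)
    and cinner :: "'a \<Rightarrow> 'a \<Rightarrow> complex"
  assumes scaleC_add_right: "a *\<^sub>C (x + y) = a *\<^sub>C x + a *\<^sub>C y"
    and scaleC_add_left: "(a + b) *\<^sub>C x = a *\<^sub>C x + b *\<^sub>C x"
    and scaleC_scaleC: "a *\<^sub>C (b *\<^sub>C x) = (a * b) *\<^sub>C x"
    and scaleR_eq_scaleC: "scaleR r x = complex_of_real r *\<^sub>C x"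
    and cinner_commute: "cinner x y = cnj (cinner y x)"
    and cinner_add_right: "cinner x (y + z) = cinner x y + cinner x z"
    and cinner_scaleC_right: "cinner x (a *\<^sub>C y) = a * cinner x y"
    and inner_eq_Re_cinner: "inner x y = Re (cinner x y)"

class complex_hilbert = complex_inner + complete_space

definition complex_infinite_dimensional :: "'a::complex_inner itself \<Rightarrow> bool" where
  "complex_infinite_dimensional _ \<longleftrightarrow>
     \<not> (\<exists>B :: 'a set. finite B \<and> module.span scaleC B = UNIV)"

definition orthonormal_on :: "nat set \<Rightarrow> (nat \<Rightarrow> 'a::complex_inner) \<Rightarrow> bool" where
  "orthonormal_on N v \<longleftrightarrow> (\<forall>i\<in>N. \<forall>j\<in>N. cinner (v i) (v j) = (if i = j then 1 else 0))"

definition orthonormal_basis :: "(nat \<Rightarrow> 'a::complex_inner) \<Rightarrow> bool" where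
  "orthonormal_basis e \<longleftrightarrow>
     orthonormal_on UNIV e \<and> (\<forall>x. (\<forall>n. cinner (e n) x = 0) \<longrightarrow> x = 0)"

section \<open>Operators and ideals\<close>

definition bounded_ops :: "('a::complex_hilbert \<Rightarrow> 'a) set" where
  "bounded_ops = {T. bounded_linear T \<and> (\<forall>a x. T (a *\<^sub>C x) = a *\<^sub>C T x)}"

definition compact_ops :: "('a::complex_hilbert \<Rightarrow> 'a) set" where
  "compact_ops = {T \<in> bounded_ops. compact (closure (T ` cball 0 1))}"

text \<open>Closure under scalar multiplication is the case of composition with a multiple
  of the identity.\<close>

definition two_sided_ideal :: "('a::complex_hilbert \<Rightarrow> 'a) set \<Rightarrow> bool" where
  "two_sided_ideal J \<longleftrightarrow> J \<subseteq> bounded_ops \<and> (\<lambda>x. 0) \<in> J \<and>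
     (\<forall>S\<in>J. \<forall>T\<in>J. (\<lambda>x. S x + T x) \<in> J) \<and>
     (\<forall>T\<in>J. \<forall>A\<in>bounded_ops. A \<circ> T \<in> J \<and> T \<circ> A \<in> J)"

definition op_ideal :: "('a::complex_hilbert \<Rightarrow> 'a) set \<Rightarrow> bool" where
  "op_ideal J \<longleftrightarrow> two_sided_ideal J \<and> J \<subseteq> compact_ops"

definition generated_ideal :: "('a::complex_hilbert \<Rightarrow> 'a) \<Rightarrow> ('a \<Rightarrow> 'a) set" where
  "generated_ideal T = \<Inter>{J. two_sided_ideal J \<and> T \<in> J}"

definition adj :: "('a::complex_hilbert \<Rightarrow> 'a) \<Rightarrow> 'a \<Rightarrow> 'a" where
  "adj T = (THE S. \<forall>x y. cinner (S x) y = cinner x (T y))"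

section \<open>Singular values\<close>

text \<open>All sequences are indexed from 0: the value at \<open>n\<close> is the (n+1)-st term of the
  sequence indexed from 1.

  For a compact operator \<open>T\<close>, \<open>s_numbers T n\<close> is the square root of the (n+1)-st largest
  eigenvalue of \<open>T\<^sup>*T\<close>, eigenvalues being repeated according to multiplicity, and 0 if there
  are at most \<open>n\<close> nonzero ones. Eigenspaces of \<open>T\<^sup>*T\<close> are mutually orthogonal, so at least
  n+1 eigenvalues, counted with multiplicity, are at least \<open>t\<^sup>2\<close> iff there are n+1
  orthonormal eigenvectors with such eigenvalues.\<close>

definition s_numbers :: "('a::complex_hilbert \<Rightarrow> 'a) \<Rightarrow> nat \<Rightarrow> real" where
  "s_numbers T n = Sup (insert 0 {t. 0 \<le> t \<and>
     (\<exists>(v :: nat \<Rightarrow> 'a) (\<mu> :: nat \<Rightarrow> real). orthonormal_on {..n} v \<and>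
        (\<forall>i\<le>n. adj T (T (v i)) = \<mu> i *\<^sub>R v i \<and> t\<^sup>2 \<le> \<mu> i))})"

definition c0_star :: "(nat \<Rightarrow> real) set" where
  "c0_star = {\<xi>. (\<forall>n. 0 \<le> \<xi> n) \<and> decseq \<xi> \<and> \<xi> \<longlonglongrightarrow> 0}"

definition char_set :: "('a::complex_hilbert \<Rightarrow> 'a) set \<Rightarrow> (nat \<Rightarrow> real) set" where
  "char_set I = s_numbers ` I"

text \<open>The ideal with a given characteristic set. An ideal is determined by its
  characteristic set (Calkin), and membership of a compact operator in it depends only on
  the sequence of singular values of that operator.\<close>

definition ideal_of_char_set :: "(nat \<Rightarrow> real) set \<Rightarrow> ('a::complex_hilbert \<Rightarrow> 'a) set" where
  "ideal_of_char_set S = {T \<in> compact_ops. s_numbers T \<in> S}"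

definition diag_op :: "(nat \<Rightarrow> 'a::complex_hilbert) \<Rightarrow> (nat \<Rightarrow> real) \<Rightarrow> 'a \<Rightarrow> 'a" where
  "diag_op e \<xi> x = (\<Sum>n. \<xi> n *\<^sub>R (cinner (e n) x *\<^sub>C e n))"

definition principal_ideal ::
    "(nat \<Rightarrow> 'a::complex_hilbert) \<Rightarrow> (nat \<Rightarrow> real) \<Rightarrow> ('a \<Rightarrow> 'a) set" where
  "principal_ideal e \<xi> = generated_ideal (diag_op e \<xi>)"

definition arith_mean :: "(nat \<Rightarrow> real) \<Rightarrow> nat \<Rightarrow> real" where
  "arith_mean \<xi> n = (\<Sum>j\<le>n. \<xi> j) / real (n + 1)"

definition pre_arith_mean :: "('a::complex_hilbert \<Rightarrow> 'a) set \<Rightarrow> ('a \<Rightarrow> 'a) set" where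
  "pre_arith_mean I = ideal_of_char_set {\<xi> \<in> c0_star. arith_mean \<xi> \<in> char_set I}"

end

theory Submission
  imports Defs
begin

text \<open>Choose \<open>\<zeta>\<close> independently of \<open>I\<close> with \<open>\<^sub>a(\<zeta>) = {0}\<close>. Since \<open>\<eta>\<^sub>a\<close> dominates a multiple of
  \<open>1/n\<close> unless \<open>\<eta> = 0\<close>, it suffices that \<open>1/n\<close> is not \<open>O(D\<^sub>m \<zeta>)\<close> for any \<open>m\<close>. A step sequence
  does this: each time drop far below \<open>1/n\<close>, then stay constant until \<open>D\<^sub>m \<xi>\<close> has become much
  smaller.

  Only one half of Calkin's correspondence is needed: elements of \<open>(\<xi>)\<close> have s-numbers
  \<open>O(D\<^sub>m \<xi>)\<close>. It holds because the operators that are bounded by a multiple of \<open>\<xi>\<^sub>k\<close> on the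
  common kernel of at most \<open>m k\<close> functionals, for all \<open>k\<close>, form an ideal containing
  \<open>diag \<xi>\<close>.\<close>

instance complex_hilbert \<subseteq> banach ..

section \<open>Riesz representation and adjoints\<close>

text \<open>Minimise \<open>Q y = inner y y - 2 * \<phi> y\<close>. Completing the square bounds
  \<open>Q\<close> below by the negative of the square of \<open>K\<close>, the parallelogram law
  makes a minimising sequence Cauchy, and the first-order condition at its limit \<open>z\<close> is
  the claimed identity.\<close>

lemma riesz_representation:
  fixes \<phi> :: "'a::{real_inner,complete_space} \<Rightarrow> real"
  assumes "bounded_linear \<phi>"
  obtains z where "\<And>y. inner z y = \<phi> y"
proof -
  interpret bounded_linear \<phi> by fact
  obtain K where K: "\<And>x. norm (\<phi> x) \<le> norm x * K" and "K > 0"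
    using pos_bounded by blast
  define Q where "Q y = inner y y - 2 * \<phi> y" for y
  define d where "d = Inf (range Q)"
  have "- (K\<^sup>2) \<le> Q y" for y
  proof -
    have "\<phi> y \<le> norm y * K" using K[of y] by simp
    moreover have "0 \<le> (norm y - K)\<^sup>2" by simp
    ultimately show ?thesis
      by (simp add: Q_def power2_diff flip: power2_norm_eq_inner)
  qed
  then have bdd: "bdd_below (range Q)" by (rule bdd_belowI2)
  have d_le: "d \<le> Q y" for y
    unfolding d_def by (rule cInf_lower) (use bdd in auto)
  have "\<exists>y. Q y < d + inverse (real (Suc n))" for n
    using cInf_lessD[of "range Q" "d + inverse (real (Suc n))"] by (auto simp: d_def)
  then obtain u where u: "\<And>n. Q (u n) < d + inverse (real (Suc n))" by metis
  \<comment> \<open>The parallelogram law at the midpoint of \<open>x\<close> and \<open>y\<close>,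
    where \<open>Q\<close> is still at least \<open>d\<close>: near-minimisers are close to each
    other.\<close>
  have gap: "(norm (x - y))\<^sup>2 \<le> 2 * (Q x - d) + 2 * (Q y - d)" for x y
  proof -
    have "Q ((1/2) *\<^sub>R (x + y)) = (Q x + Q y) / 2 - (norm (x - y))\<^sup>2 / 4"
      by (simp add: Q_def power2_norm_eq_inner inner_add_left inner_add_right inner_diff_left
          inner_diff_right scaleR add inner_commute field_simps)
    then show ?thesis using d_le[of "(1/2) *\<^sub>R (x + y)"] by (simp add: field_simps)
  qed
  have "Cauchy u"
  proof (rule metric_CauchyI)
    fix r :: real assume "0 < r"
    obtain M where M: "inverse (real (Suc M)) < r\<^sup>2 / 4"
      using reals_Archimedean[of "r\<^sup>2/4"] \<open>0 < r\<close> by auto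
    have close: "Q (u i) - d < r\<^sup>2 / 4" if "M \<le> i" for i
    proof -
      have "Q (u i) - d < inverse (real (Suc i))"
        using u[of i] by (simp only: diff_less_eq add.commute)
      also have "\<dots> \<le> inverse (real (Suc M))"
        using that by (intro le_imp_inverse_le) auto
      also note M
      finally show ?thesis .
    qed
    have "dist (u m) (u n) < r" if "m \<ge> M" "n \<ge> M" for m n
    proof -
      have "2 * (Q (u m) - d) + 2 * (Q (u n) - d) < r\<^sup>2"
        using close[OF that(1)] close[OF that(2)] by (simp add: field_simps)
      with gap[of "u m" "u n"] have "(norm (u m - u n))\<^sup>2 < r\<^sup>2" by (rule le_less_trans)
      then show ?thesis using \<open>0 < r\<close> by (auto simp: dist_norm intro: power_less_imp_less_base)
    qed
    then show "\<exists>M. \<forall>m\<ge>M. \<forall>n\<ge>M. dist (u m) (u n) < r" by blast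
  qed
  then obtain z where z: "u \<longlonglongrightarrow> z"
    using Cauchy_convergent_iff convergent_def by blast
  have "(\<lambda>n. Q (u n)) \<longlonglongrightarrow> Q z"
    unfolding Q_def by (intro tendsto_intros z tendsto)
  moreover have "(\<lambda>n. d + inverse (real (Suc n))) \<longlonglongrightarrow> d + 0"
    by (intro tendsto_intros LIMSEQ_inverse_real_of_nat)
  ultimately have "Q z \<le> d + 0"
    by (rule LIMSEQ_le) (use u less_imp_le in blast)
  then have Qz: "Q z \<le> Q y" for y using d_le[of y] by simp
  have "inner z y = \<phi> y" for y
  proof (rule ccontr)
    assume ne: "inner z y \<noteq> \<phi> y"
    define c where "c = inner z y - \<phi> y"
    define N where "N = inner y y"
    have "N > 0" using ne zero by (auto simp: N_def)
    \<comment> \<open>Along the direction \<open>y\<close>, \<open>Q\<close> is quadratic in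
      \<open>t\<close>. At its vertex \<open>t = - c / N\<close> it would fall below the minimum
      \<open>Q z\<close> unless \<open>c\<close> vanishes.\<close>
    have "Q (z + t *\<^sub>R y) = Q z + (2 * t * c + t\<^sup>2 * N)" for t
      by (simp add: Q_def N_def c_def inner_add_left inner_add_right scaleR add inner_commute
          power2_eq_square algebra_simps)
    moreover have "2 * (- c / N) * c + (- c / N)\<^sup>2 * N = - (c\<^sup>2 / N)"
      using \<open>N > 0\<close> by (simp add: power2_eq_square)
    ultimately have "Q (z + (- c / N) *\<^sub>R y) = Q z + - (c\<^sup>2 / N)"
      by (simp only:)
    moreover have "c\<^sup>2 / N > 0" using ne \<open>N > 0\<close> by (simp add: c_def)
    ultimately show False using Qz[of "z + (- c / N) *\<^sub>R y"] by (simp only:)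
  qed
  then show ?thesis by (rule that)
qed

text \<open>Multiplying the second argument by \<open>\<i>\<close> turns the imaginary part into a
  real one. This carries identities for \<open>inner\<close> over to \<open>cinner\<close>.\<close>

lemma cinner_eq_inner:
  fixes x y :: "'a::complex_inner"
  shows "cinner x y = Complex (inner x y) (- inner x (\<i> *\<^sub>C y))"
  by (simp add: complex_eq_iff inner_eq_Re_cinner cinner_scaleC_right)

lemma cinner_scaleC_left:
  fixes x y :: "'a::complex_inner"
  shows "cinner (a *\<^sub>C x) y = cnj a * cinner x y"
  by (metis cinner_commute cinner_scaleC_right complex_cnj_mult)

lemma norm_scaleC:
  fixes x :: "'a::complex_inner"
  shows "norm (a *\<^sub>C x) = cmod a * norm x"
proof -
  have "cinner (a *\<^sub>C x) (a *\<^sub>C x) = of_real ((cmod a)\<^sup>2) * cinner x x"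
    unfolding complex_norm_square by (simp add: cinner_scaleC_right cinner_scaleC_left mult_ac)
  then have "(norm (a *\<^sub>C x))\<^sup>2 = (cmod a * norm x)\<^sup>2"
    by (simp only: power2_norm_eq_inner inner_eq_Re_cinner power_mult_distrib Re_complex_of_real
        times_complex.sel Im_complex_of_real)
  then show ?thesis by simp
qed

lemma bounded_linear_scaleC: "bounded_linear (\<lambda>x::'a::complex_inner. a *\<^sub>C x)"
  by (rule bounded_linear_intro[where K = "cmod a"])
    (simp_all add: scaleC_add_right scaleR_eq_scaleC scaleC_scaleC norm_scaleC mult.commute)

text \<open>Since \<open>adj\<close> is a definite description, both existence and uniqueness are
  due. The real Riesz representation gives \<open>S\<close>; its identity at
  \<open>\<i> *\<^sub>C y\<close>, together with complex linearity of \<open>T\<close>, supplies the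
  imaginary part. Uniqueness already follows from the real parts.\<close>

lemma adj_cinner:
  fixes T :: "'a::complex_hilbert \<Rightarrow> 'a"
  assumes T: "T \<in> bounded_ops"
  shows "cinner (adj T x) y = cinner x (T y)"
proof -
  have bl: "bounded_linear T" and scC: "\<And>a x. T (a *\<^sub>C x) = a *\<^sub>C T x"
    using T by (auto simp: bounded_ops_def)
  have "\<exists>z. \<forall>y. inner z y = inner x (T y)" for x
    using riesz_representation[OF bounded_linear_compose[OF bounded_linear_inner_right bl]] by metis
  then obtain S where S: "\<And>x y. inner (S x) y = inner x (T y)" by metis
  have "\<forall>x y. cinner (adj T x) y = cinner x (T y)"
    unfolding adj_def
  proof (rule theI[where P = "\<lambda>S. \<forall>x y. cinner (S x) y = cinner x (T y)"])
    show "\<forall>x y. cinner (S x) y = cinner x (T y)"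
      by (simp add: cinner_eq_inner S scC flip: scC)
    fix R assume R: "\<forall>x y. cinner (R x) y = cinner x (T y)"
    have "inner (R x) y = inner (S x) y" for x y
      by (simp add: inner_eq_Re_cinner R) (simp add: S flip: inner_eq_Re_cinner)
    then show "R = S" by (intro ext) (metis vector_eq_rdot)
  qed
  then show ?thesis by blast
qed

section \<open>Diagonal operators\<close>

lemma orthonormal_inner:
  assumes "orthonormal_on N v" "i \<in> N" "j \<in> N"
  shows "inner (v i) (v j) = (if i = j then 1 else 0)"
  using assms by (simp add: orthonormal_on_def inner_eq_Re_cinner)

lemma norm_sum_orthonormal:
  assumes "orthonormal_on N v" "finite A" "A \<subseteq> N"
  shows "(norm (\<Sum>i\<in>A. a i *\<^sub>C v i))\<^sup>2 = (\<Sum>i\<in>A. (cmod (a i))\<^sup>2)"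
proof -
  have "norm (v i) = 1" if "i \<in> A" for i
    using orthonormal_inner[OF assms(1), of i i] that assms(3) by (auto simp: norm_eq_1)
  then have "(\<Sum>i\<in>A. (norm (a i *\<^sub>C v i))\<^sup>2) = (\<Sum>i\<in>A. (cmod (a i))\<^sup>2)"
    by (simp add: norm_scaleC)
  moreover have "pairwise (\<lambda>i j. orthogonal (a i *\<^sub>C v i) (a j *\<^sub>C v j)) A"
    using assms unfolding pairwise_def orthogonal_def inner_eq_Re_cinner orthonormal_on_def
    by (auto simp: cinner_scaleC_left cinner_scaleC_right subset_iff)
  ultimately show ?thesis
    using norm_sum_Pythagorean[OF assms(2), of "\<lambda>i. a i *\<^sub>C v i"] by simp
qed

text \<open>\<open>P\<close> is the orthogonal projection of \<open>x\<close> to the span of the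
  \<open>v i\<close>, and the two sides differ by the squared norm of \<open>x - P\<close>.\<close>

lemma bessel_inequality:
  assumes "orthonormal_on N v" "finite A" "A \<subseteq> N"
  shows "(\<Sum>i\<in>A. (cmod (cinner (v i) x))\<^sup>2) \<le> (norm x)\<^sup>2"
proof -
  define P where "P = (\<Sum>i\<in>A. cinner (v i) x *\<^sub>C v i)"
  have P: "inner P P = (\<Sum>i\<in>A. (cmod (cinner (v i) x))\<^sup>2)"
    unfolding P_def power2_norm_eq_inner[symmetric] by (rule norm_sum_orthonormal[OF assms])
  have "inner x (cinner (v i) x *\<^sub>C v i) = (cmod (cinner (v i) x))\<^sup>2" for i
  proof -
    have "inner x (cinner (v i) x *\<^sub>C v i) = Re (cinner (v i) x * cnj (cinner (v i) x))"
      unfolding inner_eq_Re_cinner cinner_scaleC_right by (subst cinner_commute[of x]) simp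
    then show ?thesis by (simp add: complex_mult_cnj cmod_power2)
  qed
  then have xP: "inner x P = (\<Sum>i\<in>A. (cmod (cinner (v i) x))\<^sup>2)"
    by (simp add: P_def inner_sum_right)
  have "0 \<le> inner (x - P) (x - P)" by simp
  also have "\<dots> = (norm x)\<^sup>2 - (\<Sum>i\<in>A. (cmod (cinner (v i) x))\<^sup>2)"
    using P xP by (simp add: inner_diff_left inner_diff_right inner_commute power2_norm_eq_inner)
  finally show ?thesis by simp
qed

lemma c0_star_antimono: "\<zeta> \<in> c0_star \<Longrightarrow> i \<le> j \<Longrightarrow> \<zeta> j \<le> \<zeta> i"
  by (auto simp: c0_star_def decseq_def)

text \<open>Pythagoras, monotonicity of \<open>\<zeta>\<close> and Bessel. The set \<open>A\<close>
  is left arbitrary so that the bound covers both the Cauchy blocks of the series and its partial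
  sums from index \<open>k\<close> on.\<close>

lemma norm_diag_sum_le:
  assumes "orthonormal_on UNIV e" "\<zeta> \<in> c0_star" "finite A" "A \<subseteq> {k..}"
  shows "norm (\<Sum>n\<in>A. \<zeta> n *\<^sub>R (cinner (e n) x *\<^sub>C e n)) \<le> \<zeta> k * norm x"
proof (rule power2_le_imp_le)
  have nn: "0 \<le> \<zeta> n" for n using assms(2) by (simp add: c0_star_def)
  have "(norm (\<Sum>n\<in>A. \<zeta> n *\<^sub>R (cinner (e n) x *\<^sub>C e n)))\<^sup>2
      = (\<Sum>n\<in>A. (\<zeta> n)\<^sup>2 * (cmod (cinner (e n) x))\<^sup>2)"
    using norm_sum_orthonormal[OF assms(1,3) subset_UNIV, of "\<lambda>n. of_real (\<zeta> n) * cinner (e n) x"]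
    by (simp add: scaleR_eq_scaleC scaleC_scaleC norm_mult power_mult_distrib)
  also have "\<dots> \<le> (\<Sum>n\<in>A. (\<zeta> k)\<^sup>2 * (cmod (cinner (e n) x))\<^sup>2)"
    using assms nn by (intro sum_mono mult_right_mono power_mono) (auto intro: c0_star_antimono)
  also have "\<dots> \<le> (\<zeta> k)\<^sup>2 * (norm x)\<^sup>2"
    using bessel_inequality[OF assms(1,3) subset_UNIV, of x]
    by (simp add: mult_left_mono flip: sum_distrib_left)
  finally show "(norm (\<Sum>n\<in>A. \<zeta> n *\<^sub>R (cinner (e n) x *\<^sub>C e n)))\<^sup>2 \<le> (\<zeta> k * norm x)\<^sup>2"
    by (simp add: power_mult_distrib)
  show "0 \<le> \<zeta> k * norm x" by (simp add: nn)
qed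

lemma summable_diag:
  fixes e :: "nat \<Rightarrow> 'a::complex_hilbert"
  assumes "orthonormal_on UNIV e" "\<zeta> \<in> c0_star"
  shows "summable (\<lambda>n. \<zeta> n *\<^sub>R (cinner (e n) x *\<^sub>C e n))"
  unfolding summable_Cauchy
proof (intro allI impI)
  fix r :: real assume "0 < r"
  have "(\<lambda>n. \<zeta> n * norm x) \<longlonglongrightarrow> 0 * norm x"
    using assms(2) by (intro tendsto_intros) (simp add: c0_star_def)
  then have "\<forall>\<^sub>F n in sequentially. \<zeta> n * norm x < r"
    using \<open>0 < r\<close> by (simp add: order_tendstoD)
  then obtain M where M: "\<zeta> n * norm x < r" if "n \<ge> M" for n
    by (auto simp: eventually_sequentially)
  have "norm (\<Sum>i = m..<n. \<zeta> i *\<^sub>R (cinner (e i) x *\<^sub>C e i)) < r" if "m \<ge> M" for m n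
    using norm_diag_sum_le[OF assms, of "{m..<n}" m x] M[OF that] by (simp add: subset_iff)
  then show "\<exists>M. \<forall>m\<ge>M. \<forall>n. norm (\<Sum>i = m..<n. \<zeta> i *\<^sub>R (cinner (e i) x *\<^sub>C e i)) < r"
    by blast
qed

text \<open>For \<open>k = 0\<close> the condition on \<open>x\<close> is vacuous and this is
  boundedness. General \<open>k\<close> is the decay on subspaces of finite codimension.\<close>

lemma norm_diag_op_le:
  fixes e :: "nat \<Rightarrow> 'a::complex_hilbert"
  assumes "orthonormal_on UNIV e" "\<zeta> \<in> c0_star" "\<And>i. i < k \<Longrightarrow> cinner (e i) x = 0"
  shows "norm (diag_op e \<zeta> x) \<le> \<zeta> k * norm x"
proof -
  let ?f = "\<lambda>n. \<zeta> n *\<^sub>R (cinner (e n) x *\<^sub>C e n)"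
  have lim: "(\<lambda>N. norm (\<Sum>n<N. ?f n)) \<longlonglongrightarrow> norm (diag_op e \<zeta> x)"
    unfolding diag_op_def by (intro tendsto_norm summable_LIMSEQ summable_diag assms)
  have "norm (\<Sum>n<N. ?f n) \<le> \<zeta> k * norm x" for N
  proof -
    have "0 *\<^sub>C e n = 0" for n using scaleR_eq_scaleC[of 0 "e n"] by simp
    then have "(\<Sum>n<N. ?f n) = (\<Sum>n\<in>{k..<N}. ?f n)"
      by (intro sum.mono_neutral_right) (auto simp: assms(3))
    then show ?thesis using norm_diag_sum_le[OF assms(1,2), of "{k..<N}" k x] by (simp add: subset_iff)
  qed
  then show ?thesis by (intro LIMSEQ_le_const2[OF lim]) auto
qed

lemma diag_op_bounded:
  fixes e :: "nat \<Rightarrow> 'a::complex_hilbert"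
  assumes "orthonormal_on UNIV e" "\<zeta> \<in> c0_star"
  shows "diag_op e \<zeta> \<in> bounded_ops"
proof -
  have add: "diag_op e \<zeta> (x + y) = diag_op e \<zeta> x + diag_op e \<zeta> y" for x y
    unfolding diag_op_def suminf_add[OF summable_diag[OF assms] summable_diag[OF assms]]
    by (simp add: cinner_add_right scaleC_add_left scaleR_add_right)
  have sc: "diag_op e \<zeta> (a *\<^sub>C x) = a *\<^sub>C diag_op e \<zeta> x" for a x
    unfolding diag_op_def bounded_linear.suminf[OF bounded_linear_scaleC summable_diag[OF assms]]
    by (simp add: cinner_scaleC_right scaleR_eq_scaleC scaleC_scaleC mult_ac)
  have "bounded_linear (diag_op e \<zeta>)"
    using norm_diag_op_le[OF assms, of 0]
    by (intro bounded_linear_intro[where K = "\<zeta> 0"])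
      (auto simp: add sc scaleR_eq_scaleC mult.commute)
  then show ?thesis by (simp add: bounded_ops_def sc)
qed

lemma diag_op_basis:
  fixes e :: "nat \<Rightarrow> 'a::complex_hilbert"
  assumes "orthonormal_on UNIV e"
  shows "diag_op e \<zeta> (e i) = \<zeta> i *\<^sub>R e i"
proof -
  have "0 *\<^sub>C e n = 0" "1 *\<^sub>C e n = e n" for n
    using scaleR_eq_scaleC[of 0 "e n"] scaleR_eq_scaleC[of 1 "e n"] by simp_all
  then have "(\<lambda>n. \<zeta> n *\<^sub>R (cinner (e n) (e i) *\<^sub>C e n)) = (\<lambda>n. if n = i then \<zeta> n *\<^sub>R e n else 0)"
    using assms by (auto simp: orthonormal_on_def)
  then show ?thesis
    unfolding diag_op_def using sums_single[of i "\<lambda>n. \<zeta> n *\<^sub>R e n"] sums_unique by fastforce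
qed

section \<open>Ideals of operators that are small on subspaces of finite codimension\<close>

text \<open>Gaussian elimination, by induction on the equations: an equation \<open>g\<close> with
  zero coefficients is dropped, and otherwise a pivot \<open>p\<close> removes one equation and one
  unknown.\<close>

lemma homogeneous_system_nontrivial:
  fixes a :: "'f \<Rightarrow> 'i \<Rightarrow> 'k::field"
  assumes "finite F" "finite Q" "card F < card Q"
  shows "\<exists>c. (\<exists>i\<in>Q. c i \<noteq> 0) \<and> (\<forall>f\<in>F. (\<Sum>i\<in>Q. c i * a f i) = 0)"
  using assms
proof (induction F arbitrary: Q a rule: finite_induct)
  case empty
  then obtain i where "i \<in> Q" by fastforce
  then show ?case by (auto intro!: exI[of _ "\<lambda>_. 1"])
next
  case (insert g F)
  show ?case
  proof (cases "\<forall>i\<in>Q. a g i = 0")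
    case True
    obtain c where "\<exists>i\<in>Q. c i \<noteq> 0" "\<forall>f\<in>F. (\<Sum>i\<in>Q. c i * a f i) = 0"
      using insert.IH[of Q a] insert.prems insert.hyps by auto
    with True show ?thesis by (auto intro!: exI[of _ c])
  next
    case False
    then obtain p where p: "p \<in> Q" "a g p \<noteq> 0" by blast
    \<comment> \<open>Subtracting a multiple of row \<open>g\<close> makes the entry in column
      \<open>p\<close> vanish in every row.\<close>
    define b where "b f i = a f i - a f p * a g i / a g p" for f i
    have "card F < card (Q - {p})" using insert.prems insert.hyps p by (simp add: card_Diff_singleton)
    then obtain c where c: "\<exists>i\<in>Q - {p}. c i \<noteq> 0" "\<forall>f\<in>F. (\<Sum>i\<in>Q - {p}. c i * b f i) = 0"
      using insert.IH[of "Q - {p}" b] insert.prems by auto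
    define s where "s = (\<Sum>i\<in>Q - {p}. c i * a g i)"
    \<comment> \<open>Back substitution: the value at \<open>p\<close> is the one that solves
      equation \<open>g\<close>.\<close>
    define c' where "c' = c(p := - s / a g p)"
    have expand: "(\<Sum>i\<in>Q. c' i * a f i) = - s / a g p * a f p + (\<Sum>i\<in>Q - {p}. c i * a f i)" for f
    proof -
      have "(\<Sum>i\<in>Q. c' i * a f i) = c' p * a f p + (\<Sum>i\<in>Q - {p}. c' i * a f i)"
        using p insert.prems by (simp add: sum.remove)
      also have "(\<Sum>i\<in>Q - {p}. c' i * a f i) = (\<Sum>i\<in>Q - {p}. c i * a f i)"
        by (intro sum.cong) (auto simp: c'_def)
      finally show ?thesis by (simp add: c'_def)
    qed
    have "(\<Sum>i\<in>Q - {p}. c i * b f i) = (\<Sum>i\<in>Q - {p}. c i * a f i) - s / a g p * a f p" for f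
      by (simp add: b_def s_def right_diff_distrib sum_subtractf sum_distrib_left sum_divide_distrib mult_ac)
    then have "\<forall>f\<in>F. (\<Sum>i\<in>Q. c' i * a f i) = 0" using c(2) expand by simp
    moreover have "(\<Sum>i\<in>Q. c' i * a g i) = 0" using p expand[of g] by (simp add: s_def)
    moreover have "\<exists>i\<in>Q. c' i \<noteq> 0" using c(1) by (auto simp: c'_def)
    ultimately show ?thesis by blast
  qed
qed

text \<open>The functionals are merely real-linear and need not be bounded; this makes composition
  with a bounded operator on the right trivial, without passing to its adjoint.\<close>

definition finite_codim_ops :: "(nat \<Rightarrow> real) \<Rightarrow> ('a::complex_hilbert \<Rightarrow> 'a) set" where
  "finite_codim_ops \<zeta> = {S \<in> bounded_ops. \<exists>C m. 0 \<le> C \<and>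
     (\<forall>k. \<exists>F :: ('a \<Rightarrow> real) set. finite F \<and> card F \<le> m * k \<and> (\<forall>f\<in>F. linear f) \<and>
        (\<forall>x. (\<forall>f\<in>F. f x = 0) \<longrightarrow> norm (S x) \<le> C * \<zeta> k * norm x))}"

lemma finite_codim_opsE:
  fixes S :: "'a::complex_hilbert \<Rightarrow> 'a"
  assumes "S \<in> finite_codim_ops \<zeta>"
  obtains C m F where "0 \<le> C" "\<And>k. finite (F k)" "\<And>k. card (F k) \<le> m * k"
    "\<And>k f. f \<in> F k \<Longrightarrow> linear (f :: 'a \<Rightarrow> real)"
    "\<And>k x. (\<And>f. f \<in> F k \<Longrightarrow> f x = 0) \<Longrightarrow> norm (S x) \<le> C * \<zeta> k * norm x"
proof -
  obtain C m where "0 \<le> C" and ex: "\<forall>k. \<exists>F :: ('a \<Rightarrow> real) set. finite F \<and> card F \<le> m * k \<and>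
      (\<forall>f\<in>F. linear f) \<and> (\<forall>x. (\<forall>f\<in>F. f x = 0) \<longrightarrow> norm (S x) \<le> C * \<zeta> k * norm x)"
    using assms unfolding finite_codim_ops_def by blast
  from choice[OF ex] obtain F :: "nat \<Rightarrow> ('a \<Rightarrow> real) set" where
    "\<forall>k. finite (F k) \<and> card (F k) \<le> m * k \<and>
      (\<forall>f\<in>F k. linear f) \<and> (\<forall>x. (\<forall>f\<in>F k. f x = 0) \<longrightarrow> norm (S x) \<le> C * \<zeta> k * norm x)" ..
  with \<open>0 \<le> C\<close> show ?thesis by (intro that[of C F m]) blast+
qed

lemma finite_codim_opsI:
  fixes S :: "'a::complex_hilbert \<Rightarrow> 'a"
  assumes "S \<in> bounded_ops" "0 \<le> C" "\<And>k. finite (F k)" "\<And>k. card (F k) \<le> m * k"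
    "\<And>k f. f \<in> F k \<Longrightarrow> linear (f :: 'a \<Rightarrow> real)"
    "\<And>k x. (\<And>f. f \<in> F k \<Longrightarrow> f x = 0) \<Longrightarrow> norm (S x) \<le> C * \<zeta> k * norm x"
  shows "S \<in> finite_codim_ops \<zeta>"
  unfolding finite_codim_ops_def
  using assms by (intro CollectI conjI exI[of _ C] exI[of _ m] allI exI[of _ "F _"]) auto

lemma bounded_ops_compose: "A \<in> bounded_ops \<Longrightarrow> T \<in> bounded_ops \<Longrightarrow> A \<circ> T \<in> bounded_ops"
  by (auto simp: bounded_ops_def o_def intro: bounded_linear_compose)

text \<open>For a sum, take the union of the functionals and add the constants. Composition with
  \<open>A\<close> on the left only enlarges \<open>C\<close>. On the right, the functionals are
  pulled back along \<open>A\<close>: if all \<open>f \<circ> A\<close> kill \<open>x\<close>, then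
  all \<open>f\<close> kill \<open>A x\<close>.\<close>

lemma two_sided_ideal_finite_codim_ops:
  fixes \<zeta> :: "nat \<Rightarrow> real"
  assumes nn: "\<And>n. 0 \<le> \<zeta> n"
  shows "two_sided_ideal (finite_codim_ops \<zeta> :: ('a::complex_hilbert \<Rightarrow> 'a) set)"
  unfolding two_sided_ideal_def
proof (intro conjI ballI)
  show "finite_codim_ops \<zeta> \<subseteq> (bounded_ops :: ('a \<Rightarrow> 'a) set)"
    by (auto simp: finite_codim_ops_def)
  have "a *\<^sub>C (0::'a) = 0" for a
    using linear_0[OF bounded_linear.linear[OF bounded_linear_scaleC]] .
  then show "(\<lambda>x::'a. 0) \<in> finite_codim_ops \<zeta>"
    by (intro finite_codim_opsI[where C = 0 and m = 0 and F = "\<lambda>_. {}"]) (auto simp: bounded_ops_def)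
next
  fix S T :: "'a \<Rightarrow> 'a"
  assume S: "S \<in> finite_codim_ops \<zeta>" and T: "T \<in> finite_codim_ops \<zeta>"
  obtain C m F where F: "0 \<le> C" "\<And>k. finite (F k)" "\<And>k. card (F k) \<le> m * k"
    "\<And>k f. f \<in> F k \<Longrightarrow> linear (f :: 'a \<Rightarrow> real)"
    "\<And>k x. (\<And>f. f \<in> F k \<Longrightarrow> f x = 0) \<Longrightarrow> norm (S x) \<le> C * \<zeta> k * norm x"
    using S by (rule finite_codim_opsE) blast
  obtain D n G where G: "0 \<le> D" "\<And>k. finite (G k)" "\<And>k. card (G k) \<le> n * k"
    "\<And>k f. f \<in> G k \<Longrightarrow> linear (f :: 'a \<Rightarrow> real)"
    "\<And>k x. (\<And>f. f \<in> G k \<Longrightarrow> f x = 0) \<Longrightarrow> norm (T x) \<le> D * \<zeta> k * norm x"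
    using T by (rule finite_codim_opsE) blast
  show "(\<lambda>x. S x + T x) \<in> finite_codim_ops \<zeta>"
  proof (rule finite_codim_opsI[where C = "C + D" and m = "m + n" and F = "\<lambda>k. F k \<union> G k"])
    show "(\<lambda>x. S x + T x) \<in> bounded_ops"
      using S T by (auto simp: finite_codim_ops_def bounded_ops_def scaleC_add_right
          intro: bounded_linear_add)
    show "card (F k \<union> G k) \<le> (m + n) * k" for k
      using card_Un_le[of "F k" "G k"] F(3)[of k] G(3)[of k] by (simp add: algebra_simps)
    show "norm (S x + T x) \<le> (C + D) * \<zeta> k * norm x"
      if "\<And>f. f \<in> F k \<union> G k \<Longrightarrow> f x = 0" for k x
      using norm_triangle_ineq[of "S x" "T x"] F(5)[of k x] G(5)[of k x] that
      by (simp add: algebra_simps)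
  qed (use F G in auto)
next
  fix T A :: "'a \<Rightarrow> 'a"
  assume T: "T \<in> finite_codim_ops \<zeta>" and A: "A \<in> bounded_ops"
  obtain C m F where F: "0 \<le> C" "\<And>k. finite (F k)" "\<And>k. card (F k) \<le> m * k"
    "\<And>k f. f \<in> F k \<Longrightarrow> linear (f :: 'a \<Rightarrow> real)"
    "\<And>k x. (\<And>f. f \<in> F k \<Longrightarrow> f x = 0) \<Longrightarrow> norm (T x) \<le> C * \<zeta> k * norm x"
    using T by (rule finite_codim_opsE) blast
  have T': "T \<in> bounded_ops" using T by (simp add: finite_codim_ops_def)
  interpret A: bounded_linear A using A by (simp add: bounded_ops_def)
  obtain K where "K > 0" and K: "\<And>x. norm (A x) \<le> norm x * K" using A.pos_bounded by blast
  show "A \<circ> T \<in> finite_codim_ops \<zeta>"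
  proof (rule finite_codim_opsI[where C = "K * C" and m = m and F = F])
    show "norm ((A \<circ> T) x) \<le> K * C * \<zeta> k * norm x" if "\<And>f. f \<in> F k \<Longrightarrow> f x = 0" for k x
    proof -
      have "norm (A (T x)) \<le> K * norm (T x)" using K[of "T x"] by (simp add: mult.commute)
      also have "\<dots> \<le> K * (C * \<zeta> k * norm x)"
        using F(5)[of k x] that \<open>K > 0\<close> by (intro mult_left_mono) auto
      finally show ?thesis by (simp add: mult_ac)
    qed
  qed (use F \<open>K > 0\<close> bounded_ops_compose[OF A T'] in auto)
  show "T \<circ> A \<in> finite_codim_ops \<zeta>"
  proof (rule finite_codim_opsI[where C = "C * K" and m = m and F = "\<lambda>k. (\<lambda>f. f \<circ> A) ` F k"])
    show "card ((\<lambda>f. f \<circ> A) ` F k) \<le> m * k" for k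
      using card_image_le[OF F(2)] F(3) by (rule order_trans)
    show "linear f" if "f \<in> (\<lambda>f. f \<circ> A) ` F k" for k f
      using that F(4) A.linear by (auto intro: linear_compose)
    show "norm ((T \<circ> A) x) \<le> C * K * \<zeta> k * norm x"
      if "\<And>f. f \<in> (\<lambda>f. f \<circ> A) ` F k \<Longrightarrow> f x = 0" for k x
    proof -
      have "norm (T (A x)) \<le> C * \<zeta> k * norm (A x)"
        using that[of "_ \<circ> A"] by (intro F(5)) force
      also have "\<dots> \<le> C * \<zeta> k * (norm x * K)"
        using K[of x] F(1) nn by (intro mult_left_mono) auto
      finally show ?thesis by (simp add: mult_ac)
    qed
  qed (use F \<open>K > 0\<close> bounded_ops_compose[OF T' A] in auto)
qed

text \<open>The functionals are the real and imaginary parts of the first \<open>k\<close>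
  coordinates, hence \<open>m = 2\<close>.\<close>

lemma diag_op_finite_codim:
  fixes e :: "nat \<Rightarrow> 'a::complex_hilbert"
  assumes "orthonormal_on UNIV e" "\<zeta> \<in> c0_star"
  shows "diag_op e \<zeta> \<in> finite_codim_ops \<zeta>"
proof (rule finite_codim_opsI[where C = 1 and m = 2 and
      F = "\<lambda>k. (\<lambda>i x. Re (cinner (e i) x)) ` {..<k} \<union> (\<lambda>i x. Im (cinner (e i) x)) ` {..<k}"])
  fix k
  let ?R = "(\<lambda>i x. Re (cinner (e i) x)) ` {..<k}" and ?I = "(\<lambda>i x. Im (cinner (e i) x)) ` {..<k}"
  have "card ?R \<le> k" "card ?I \<le> k"
    using card_image_le[of "{..<k}"] by (metis card_lessThan finite_lessThan)+
  then show "card (?R \<union> ?I) \<le> 2 * k" using card_Un_le[of ?R ?I] by linarith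
  show "linear f" if "f \<in> ?R \<union> ?I" for f
    using that by (auto intro!: linearI simp: cinner_add_right scaleR_eq_scaleC cinner_scaleC_right)
  fix x assume "\<And>f. f \<in> ?R \<union> ?I \<Longrightarrow> f x = 0"
  then have "cinner (e i) x = 0" if "i < k" for i using that by (auto simp: complex_eq_iff)
  then show "norm (diag_op e \<zeta> x) \<le> 1 * \<zeta> k * norm x" using norm_diag_op_le[OF assms] by simp
qed (use diag_op_bounded[OF assms] in auto)

lemma principal_ideal_subset:
  fixes e :: "nat \<Rightarrow> 'a::complex_hilbert"
  assumes "orthonormal_on UNIV e" "\<zeta> \<in> c0_star"
  shows "principal_ideal e \<zeta> \<subseteq> finite_codim_ops \<zeta>"
  unfolding principal_ideal_def generated_ideal_def
  using two_sided_ideal_finite_codim_ops[of \<zeta>] diag_op_finite_codim[OF assms] assms(2)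
  by (intro Inter_lower) (auto simp: c0_star_def)

text \<open>A subspace of dimension exceeding \<^term>\<open>m * k\<close> contains a nonzero vector killed by all
  the functionals.\<close>

lemma finite_codim_ops_bound:
  fixes S :: "'a::complex_hilbert \<Rightarrow> 'a"
  assumes S: "S \<in> finite_codim_ops \<zeta>"
  obtains C m where "0 \<le> C"
    "\<And>k n t v. m * k \<le> n \<Longrightarrow> orthonormal_on {..n} v \<Longrightarrow> 0 \<le> t \<Longrightarrow>
       (\<And>i j. i \<le> n \<Longrightarrow> j \<le> n \<Longrightarrow> i \<noteq> j \<Longrightarrow> inner (S (v i)) (S (v j)) = 0) \<Longrightarrow>
       (\<And>i. i \<le> n \<Longrightarrow> t \<le> norm (S (v i))) \<Longrightarrow> t \<le> C * \<zeta> k"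
proof -
  obtain C m F where F: "0 \<le> C" "\<And>k. finite (F k)" "\<And>k. card (F k) \<le> m * k"
    "\<And>k f. f \<in> F k \<Longrightarrow> linear (f :: 'a \<Rightarrow> real)"
    "\<And>k x. (\<And>f. f \<in> F k \<Longrightarrow> f x = 0) \<Longrightarrow> norm (S x) \<le> C * \<zeta> k * norm x"
    using S by (rule finite_codim_opsE) blast
  have linS: "linear S"
    using S by (auto simp: finite_codim_ops_def bounded_ops_def bounded_linear.linear)
  show ?thesis
  proof (rule that[of C m, OF F(1)])
    fix k n t and v :: "nat \<Rightarrow> 'a"
    assume kn: "m * k \<le> n" and on: "orthonormal_on {..n} v" and t: "0 \<le> t"
      and orth: "\<And>i j. i \<le> n \<Longrightarrow> j \<le> n \<Longrightarrow> i \<noteq> j \<Longrightarrow> inner (S (v i)) (S (v j)) = 0"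
      and low: "\<And>i. i \<le> n \<Longrightarrow> t \<le> norm (S (v i))"
    \<comment> \<open>\<open>{..n}\<close> has \<open>n + 1\<close> elements, one more than
      \<open>n\<close>, so there are fewer functionals than vectors \<open>v i\<close>.\<close>
    have "card (F k) < card {..n}" using F(3)[of k] kn by simp
    from homogeneous_system_nontrivial[OF F(2) _ this, of "\<lambda>f i. f (v i)"]
    obtain c where c: "\<exists>i\<in>{..n}. c i \<noteq> 0" "\<And>f. f \<in> F k \<Longrightarrow> (\<Sum>i\<le>n. c i * f (v i)) = 0"
      by auto
    define x where "x = (\<Sum>i\<le>n. c i *\<^sub>R v i)"
    have "f x = 0" if "f \<in> F k" for f
      using c(2)[OF that] by (simp add: x_def linear_sum[OF F(4)[OF that]] linear_scale[OF F(4)[OF that]])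
    then have up: "norm (S x) \<le> C * \<zeta> k * norm x" by (rule F(5))
    have "(norm x)\<^sup>2 = (\<Sum>i\<le>n. (norm (c i *\<^sub>R v i))\<^sup>2)"
      unfolding x_def using orthonormal_inner[OF on]
      by (intro norm_sum_Pythagorean) (auto simp: pairwise_def orthogonal_def)
    also have "\<dots> = (\<Sum>i\<le>n. (c i)\<^sup>2)"
      using orthonormal_inner[OF on]
      by (intro sum.cong) (auto simp: power_mult_distrib power2_norm_eq_inner)
    finally have nx: "(norm x)\<^sup>2 = (\<Sum>i\<le>n. (c i)\<^sup>2)" .
    moreover have "(\<Sum>i\<le>n. (c i)\<^sup>2) > 0" using c(1) by (auto intro: sum_pos2)
    ultimately have "norm x > 0" by (metis power_zero_numeral zero_less_norm_iff norm_zero less_irrefl)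
    \<comment> \<open>The images \<open>S (v i)\<close> are orthogonal too, so Pythagoras bounds the
      norm of \<open>S x\<close> from below by \<open>t * norm x\<close>, against the upper bound
      \<open>up\<close>.\<close>
    have "(norm (S x))\<^sup>2 = (\<Sum>i\<le>n. (norm (c i *\<^sub>R S (v i)))\<^sup>2)"
      unfolding x_def linear_sum[OF linS] linear_scale[OF linS]
      by (intro norm_sum_Pythagorean) (auto simp: pairwise_def orthogonal_def orth)
    also have "\<dots> \<ge> (\<Sum>i\<le>n. (c i)\<^sup>2 * t\<^sup>2)"
      using low t by (intro sum_mono) (auto simp: power_mult_distrib intro!: mult_left_mono power_mono)
    finally have "(t * norm x)\<^sup>2 \<le> (norm (S x))\<^sup>2"
      by (simp add: nx power_mult_distrib mult.commute flip: sum_distrib_left sum_distrib_right)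
    then have "t * norm x \<le> norm (S x)" by (rule power2_le_imp_le) simp
    also note up
    finally show "t \<le> C * \<zeta> k" using \<open>norm x > 0\<close> by simp
  qed
qed

text \<open>Orthonormal eigenvectors of \<open>adj S \<circ> S\<close> have orthogonal images under
  \<open>S\<close>, with squared norms \<open>\<mu> i\<close>, so every candidate \<open>t\<close>
  in the supremum obeys the bound. With indices from 0, \<open>D_m \<zeta>\<close> has the value
  \<open>\<zeta> k\<close> at \<open>m * k\<close>; for \<open>m > 0\<close> the conclusion is thus
  the O-estimate at the first index of each block of length \<open>m\<close>.\<close>

lemma s_numbers_finite_codim:
  fixes S :: "'a::complex_hilbert \<Rightarrow> 'a"
  assumes S: "S \<in> finite_codim_ops \<zeta>" and nn: "\<And>n. 0 \<le> \<zeta> n"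
  obtains C m where "0 \<le> C" "\<And>k. s_numbers S (m * k) \<le> C * \<zeta> k"
proof -
  obtain C m where "0 \<le> C" and bound: "\<And>k n t v. m * k \<le> n \<Longrightarrow> orthonormal_on {..n} v \<Longrightarrow> 0 \<le> t \<Longrightarrow>
       (\<And>i j. i \<le> n \<Longrightarrow> j \<le> n \<Longrightarrow> i \<noteq> j \<Longrightarrow> inner (S (v i)) (S (v j)) = 0) \<Longrightarrow>
       (\<And>i. i \<le> n \<Longrightarrow> t \<le> norm (S (v i))) \<Longrightarrow> t \<le> C * \<zeta> k"
    using S by (rule finite_codim_ops_bound) blast
  have Sb: "S \<in> bounded_ops" using S by (simp add: finite_codim_ops_def)
  have "s_numbers S (m * k) \<le> C * \<zeta> k" for k
    unfolding s_numbers_def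
  proof (rule cSup_least)
    fix t assume "t \<in> insert 0 {t. 0 \<le> t \<and>
     (\<exists>(v :: nat \<Rightarrow> 'a) (\<mu> :: nat \<Rightarrow> real). orthonormal_on {..m * k} v \<and>
        (\<forall>i\<le>m * k. adj S (S (v i)) = \<mu> i *\<^sub>R v i \<and> t\<^sup>2 \<le> \<mu> i))}"
    then consider "t = 0" | v \<mu> where "0 \<le> t" "orthonormal_on {..m * k} (v :: nat \<Rightarrow> 'a)"
      "\<And>i. i \<le> m * k \<Longrightarrow> adj S (S (v i)) = \<mu> i *\<^sub>R v i" "\<And>i. i \<le> m * k \<Longrightarrow> t\<^sup>2 \<le> \<mu> i"
      by blast
    then show "t \<le> C * \<zeta> k"
    proof cases
      case 1
      then show ?thesis using \<open>0 \<le> C\<close> nn by simp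
    next
      case 2
      have ip: "inner (S (v i)) (S (v j)) = (if i = j then \<mu> i else 0)" if "i \<le> m * k" "j \<le> m * k" for i j
      proof -
        have "inner (S (v i)) (S (v j)) = inner (adj S (S (v i))) (v j)"
          by (simp add: inner_eq_Re_cinner adj_cinner[OF Sb])
        also have "\<dots> = \<mu> i * inner (v i) (v j)" by (simp add: 2(3) that)
        finally show ?thesis using orthonormal_inner[OF 2(2), of i j] that by simp
      qed
      have "t \<le> norm (S (v i))" if "i \<le> m * k" for i
      proof (rule power2_le_imp_le)
        show "t\<^sup>2 \<le> (norm (S (v i)))\<^sup>2"
          using 2(4)[OF that] ip[OF that that] by (simp add: power2_norm_eq_inner)
      qed simp
      with 2 ip show ?thesis by (intro bound[of k "m * k" v]) auto
    qed
  qed simp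
  with \<open>0 \<le> C\<close> show ?thesis by (rule that)
qed

text \<open>The test vectors are the basis vectors up to index \<open>m * k\<close>. Their images
  are orthogonal of norm at least \<open>\<zeta> (m * k)\<close>, which gives the estimate without
  computing the s-numbers of the diagonal operator.\<close>

lemma diag_op_in_finite_codim_ops_bound:
  fixes e :: "nat \<Rightarrow> 'a::complex_hilbert"
  assumes on: "orthonormal_on UNIV e" and \<zeta>: "\<zeta> \<in> c0_star"
    and "diag_op e \<zeta> \<in> finite_codim_ops \<xi>"
  obtains C m where "0 \<le> C" "\<And>k. \<zeta> (m * k) \<le> C * \<xi> k"
proof -
  obtain C m where "0 \<le> C" and bound: "\<And>k n t v. m * k \<le> n \<Longrightarrow> orthonormal_on {..n} v \<Longrightarrow> 0 \<le> t \<Longrightarrow>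
       (\<And>i j. i \<le> n \<Longrightarrow> j \<le> n \<Longrightarrow> i \<noteq> j \<Longrightarrow> inner (diag_op e \<zeta> (v i)) (diag_op e \<zeta> (v j)) = 0) \<Longrightarrow>
       (\<And>i. i \<le> n \<Longrightarrow> t \<le> norm (diag_op e \<zeta> (v i))) \<Longrightarrow> t \<le> C * \<xi> k"
    using assms(3) by (rule finite_codim_ops_bound) blast
  have nn: "0 \<le> \<zeta> n" for n using \<zeta> by (simp add: c0_star_def)
  have "norm (e i) = 1" for i using orthonormal_inner[OF on, of i i] by (simp add: norm_eq_1)
  then have "\<zeta> (m * k) \<le> C * \<xi> k" for k
    using on nn orthonormal_inner[OF on]
    by (intro bound[of k "m * k" e])
      (auto simp: orthonormal_on_def diag_op_basis[OF on] intro: c0_star_antimono[OF \<zeta>])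
  with \<open>0 \<le> C\<close> show ?thesis by (rule that)
qed

section \<open>The step sequence\<close>

text \<open>The sequence has the value \<open>\<delta> j\<close> for indices from \<open>N j\<close>
  up to, but excluding, \<open>N (Suc j)\<close>. At the left end of a block its product with the
  1-based index is \<open>1 / (j + 1)\<close>, which gives the last property. The block is long
  enough to contain \<open>(j + 1) * k\<close> for some \<open>k\<close> at which
  \<open>(j + 1) * \<xi> k\<close> is already below \<open>\<delta> j\<close>, which gives the
  second.\<close>

lemma step_sequence_exists:
  assumes \<xi>: "\<xi> \<in> c0_star"
  obtains \<zeta> where "\<zeta> \<in> c0_star"
    "\<And>C m. \<exists>k. C * \<xi> k < \<zeta> (m * k)"
    "\<And>a. 0 < a \<Longrightarrow> \<exists>k. real (k + 1) * \<zeta> k < a"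
proof -
  have \<xi>nn: "0 \<le> \<xi> n" for n using \<xi> by (simp add: c0_star_def)
  define \<epsilon> where "\<epsilon> j N = 1 / (real (j + 1) * real (N + 1))" for j N
  have "\<exists>k\<ge>N. real (j + 1) * \<xi> k < \<epsilon> j N" for j N
  proof -
    have "(\<lambda>k. real (j + 1) * \<xi> k) \<longlonglongrightarrow> real (j + 1) * 0"
      using \<xi> by (intro tendsto_intros) (simp add: c0_star_def)
    moreover have "0 < \<epsilon> j N" by (simp add: \<epsilon>_def)
    ultimately have "\<forall>\<^sub>F k in sequentially. real (j + 1) * \<xi> k < \<epsilon> j N"
      by (metis mult_zero_right order_tendstoD(2))
    then have "\<forall>\<^sub>F k in sequentially. N \<le> k \<and> real (j + 1) * \<xi> k < \<epsilon> j N"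
      using eventually_ge_at_top[of N] by eventually_elim auto
    then show ?thesis by (metis (mono_tags, lifting) eventually_happens sequentially_bot)
  qed
  then have "\<forall>j N. \<exists>k. N \<le> k \<and> real (j + 1) * \<xi> k < \<epsilon> j N" by blast
  then obtain \<kappa> where "\<forall>j N. N \<le> \<kappa> j N \<and> real (j + 1) * \<xi> (\<kappa> j N) < \<epsilon> j N"
    unfolding choice_iff by blast
  then have \<kappa>: "\<And>j N. N \<le> \<kappa> j N" "\<And>j N. real (j + 1) * \<xi> (\<kappa> j N) < \<epsilon> j N"
    by blast+
  \<comment> \<open>The final \<open>+ 1\<close> keeps the index
    \<open>(j + 1) * \<kappa> j (N j)\<close> inside block \<open>j\<close>.\<close>
  define N where "N = rec_nat 0 (\<lambda>j N. (j + 1) * \<kappa> j N + 1)"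
  have N_Suc: "N (Suc j) = (j + 1) * \<kappa> j (N j) + 1" for j by (simp add: N_def)
  have "N j < N (Suc j)" for j
    using \<kappa>(1)[of "N j" j] by (simp add: N_Suc)
  then have sm: "strict_mono N" by (simp add: strict_mono_Suc_iff)
  \<comment> \<open>The number of the block that contains \<open>n\<close>.\<close>
  define L where "L n = (LEAST j. n < N (Suc j))" for n
  have L_less: "n < N (Suc (L n))" for n
  proof -
    have "n < N (Suc n)" using strict_mono_imp_increasing[OF sm, of "Suc n"] by simp
    then show ?thesis unfolding L_def by (rule LeastI)
  qed
  have L_le: "L n \<le> j" if "n < N (Suc j)" for n j
    unfolding L_def using that by (rule Least_le)
  have L_ge: "j \<le> L n" if "N j \<le> n" for n j
  proof -
    have "N j < N (Suc (L n))" using that L_less[of n] by simp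
    then show ?thesis using strict_mono_less[OF sm] by simp
  qed
  have L_N: "L (N j) = j" for j
    using L_ge[of j "N j"] L_le[of "N j" j] sm by (simp add: strict_mono_Suc_iff order_antisym)
  define \<delta> where "\<delta> j = \<epsilon> j (N j)" for j
  have \<delta>_mono: "\<delta> j \<le> \<delta> i" if "i \<le> j" for i j
    using that strict_mono_less_eq[OF sm, of i j] unfolding \<delta>_def \<epsilon>_def
    by (intro divide_left_mono mult_mono) auto
  have \<delta>_le: "\<delta> j \<le> inverse (real (Suc j))" for j
    unfolding \<delta>_def \<epsilon>_def inverse_eq_divide by (intro divide_left_mono) auto
  have \<delta>_nn: "0 \<le> \<delta> j" for j by (simp add: \<delta>_def \<epsilon>_def)
  have L_mono: "mono L"
    using L_less by (intro monoI L_le) (meson le_less_trans)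
  have small: "\<exists>j. \<delta> j < r \<and> inverse (real (Suc j)) < r" if "0 < r" for r
    using reals_Archimedean[OF that] \<delta>_le by (meson le_less_trans)
  show ?thesis
  proof (rule that[of "\<lambda>n. \<delta> (L n)"])
    have "(\<lambda>n. \<delta> (L n)) \<longlonglongrightarrow> 0"
    proof (rule LIMSEQ_I)
      fix r :: real assume "0 < r"
      then obtain j where j: "\<delta> j < r" using small by blast
      have "norm (\<delta> (L n) - 0) < r" if "n \<ge> N j" for n
        using \<delta>_mono[OF L_ge[OF that]] j \<delta>_nn[of "L n"] by simp
      then show "\<exists>M. \<forall>n\<ge>M. norm (\<delta> (L n) - 0) < r" by blast
    qed
    then show "(\<lambda>n. \<delta> (L n)) \<in> c0_star"
      using \<delta>_nn \<delta>_mono monoD[OF L_mono] by (auto simp: c0_star_def decseq_def)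
  next
    fix C :: real and m :: nat
    obtain j0 :: nat where j0: "C \<le> real j0" using real_arch_simple by blast
    \<comment> \<open>Block \<open>j\<close> is late enough for both \<open>C\<close> and
      \<open>m\<close>. The index \<open>m * k\<close> may lie in an earlier block, where the
      sequence is at least \<open>\<delta> j\<close>.\<close>
    define j where "j = max j0 m"
    define k where "k = \<kappa> j (N j)"
    have "m * k \<le> (j + 1) * k" by (rule mult_right_mono) (auto simp: j_def)
    then have "m * k < N (Suc j)" by (simp add: N_Suc k_def)
    then have "\<delta> j \<le> \<delta> (L (m * k))" by (intro \<delta>_mono L_le)
    moreover have "C * \<xi> k \<le> real (j + 1) * \<xi> k"
      using j0 \<xi>nn by (intro mult_right_mono) (auto simp: j_def)
    moreover have "real (j + 1) * \<xi> k < \<delta> j" using \<kappa>(2) by (simp add: k_def \<delta>_def)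
    ultimately show "\<exists>k. C * \<xi> k < \<delta> (L (m * k))" by (intro exI[of _ k]) linarith
  next
    fix a :: real assume "0 < a"
    then obtain j where j: "inverse (real (Suc j)) < a" using small by blast
    have "real (N j + 1) * \<delta> (L (N j)) = inverse (real (Suc j))"
      by (simp add: L_N \<delta>_def \<epsilon>_def inverse_eq_divide del: of_nat_Suc of_nat_add)
    with j show "\<exists>k. real (k + 1) * \<delta> (L k) < a" by (intro exI[of _ "N j"]) simp
  qed
qed

section \<open>Vanishing of the pre-arithmetic mean, and the theorem\<close>

lemma arith_mean_ge:
  assumes "\<And>n. 0 \<le> \<eta> n"
  shows "\<eta> 0 / real (n + 1) \<le> arith_mean \<eta> n"
proof -
  have "\<eta> 0 \<le> (\<Sum>j\<le>n. \<eta> j)" using assms by (intro member_le_sum) auto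
  then show ?thesis unfolding arith_mean_def by (simp add: divide_right_mono)
qed

text \<open>Every eigenvalue of the zero operator is 0, so only \<open>t = 0\<close> competes in the
  supremum. This puts the zero sequence into the characteristic set of every ideal.\<close>

lemma s_numbers_zero: "s_numbers (\<lambda>x::'a::complex_hilbert. 0) = (\<lambda>n. 0)"
proof
  fix n
  have zero_op: "(\<lambda>x::'a. 0) \<in> bounded_ops"
    using two_sided_ideal_finite_codim_ops[of "\<lambda>n. 0"]
    by (auto simp: two_sided_ideal_def)
  have "t = 0" if "0 \<le> t" "orthonormal_on {..n} v"
    "\<forall>i\<le>n. adj (\<lambda>x. 0) (0 :: 'a) = \<mu> i *\<^sub>R v i \<and> t\<^sup>2 \<le> \<mu> i" for t v \<mu>
  proof -
    have "\<mu> 0 = inner (adj (\<lambda>x. 0) (0 :: 'a)) (v 0)"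
      using that(3) orthonormal_inner[OF that(2), of 0 0] by (metis inner_scaleR_left
          atMost_iff le0 mult.right_neutral)
    also have "\<dots> = 0" by (simp add: inner_eq_Re_cinner adj_cinner[OF zero_op])
      (simp flip: inner_eq_Re_cinner)
    finally show "t = 0" using that(3) by (metis le0 power2_less_eq_zero_iff)
  qed
  then have "insert 0 {t. 0 \<le> t \<and> (\<exists>(v :: nat \<Rightarrow> 'a) (\<mu> :: nat \<Rightarrow> real). orthonormal_on {..n} v \<and>
        (\<forall>i\<le>n. adj (\<lambda>x. 0) 0 = \<mu> i *\<^sub>R v i \<and> t\<^sup>2 \<le> \<mu> i))} = {0}"
    by blast
  then show "s_numbers (\<lambda>x::'a. 0) n = 0" unfolding s_numbers_def by (simp only: cSup_singleton)
qed

theorem proposition6p8: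
  fixes e :: "nat \<Rightarrow> 'a::complex_hilbert"
    and I :: "('a \<Rightarrow> 'a) set"
    and \<xi> :: "nat \<Rightarrow> real"
  assumes "separable_space (euclidean :: 'a topology)"
    and "complex_infinite_dimensional TYPE('a)"
    and "orthonormal_basis e"
    and "op_ideal I"
    and "\<xi> \<in> c0_star"
  shows "\<exists>\<zeta>\<in>c0_star. \<not> principal_ideal e \<zeta> \<subseteq> principal_ideal e \<xi> \<and>
           pre_arith_mean (principal_ideal e \<zeta>) \<subseteq> pre_arith_mean I"
proof -
  have on: "orthonormal_on UNIV e" using assms(3) by (simp add: orthonormal_basis_def)
  obtain \<zeta> where \<zeta>: "\<zeta> \<in> c0_star" and not_O: "\<And>C m. \<exists>k. C * \<xi> k < \<zeta> (m * k)"
    and small: "\<And>a. 0 < a \<Longrightarrow> \<exists>k. real (k + 1) * \<zeta> k < a"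
    using step_sequence_exists[OF assms(5)] by blast
  have nn: "0 \<le> \<zeta> n" for n using \<zeta> by (simp add: c0_star_def)
  have "diag_op e \<zeta> \<in> principal_ideal e \<zeta>"
    by (simp add: principal_ideal_def generated_ideal_def)
  moreover have "diag_op e \<zeta> \<notin> principal_ideal e \<xi>"
  proof
    assume "diag_op e \<zeta> \<in> principal_ideal e \<xi>"
    then have "diag_op e \<zeta> \<in> finite_codim_ops \<xi>"
      using principal_ideal_subset[OF on assms(5)] by blast
    from diag_op_in_finite_codim_ops_bound[OF on \<zeta> this]
    obtain C m where "\<And>k. \<zeta> (m * k) \<le> C * \<xi> k" by blast
    with not_O[of C m] show False by (meson not_less)
  qed
  moreover have "T \<in> pre_arith_mean I" if T: "T \<in> pre_arith_mean (principal_ideal e \<zeta>)" for T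
  proof -
    define \<eta> where "\<eta> = s_numbers T"
    obtain S where S: "S \<in> principal_ideal e \<zeta>" "arith_mean \<eta> = s_numbers S"
      and \<eta>: "\<eta> \<in> c0_star" and "T \<in> compact_ops"
      using T by (auto simp: pre_arith_mean_def ideal_of_char_set_def char_set_def \<eta>_def)
    have \<eta>nn: "0 \<le> \<eta> n" for n using \<eta> by (simp add: c0_star_def)
    have "S \<in> finite_codim_ops \<zeta>" using S(1) principal_ideal_subset[OF on \<zeta>] by blast
    from s_numbers_finite_codim[OF this nn] obtain C m
      where "0 \<le> C" and bound: "\<And>k. s_numbers S (m * k) \<le> C * \<zeta> k" by blast
    \<comment> \<open>Otherwise the arithmetic mean decays no faster than a multiple of
      \<open>1/n\<close>, and the bound at \<open>m * k\<close> would keep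
      \<open>(k + 1) * \<zeta> k\<close> away from 0.\<close>
    have "\<eta> 0 = 0"
    proof (rule ccontr)
      assume "\<eta> 0 \<noteq> 0"
      then have "0 < \<eta> 0" using \<eta>nn[of 0] by simp
      \<comment> \<open>\<open>C + 1\<close> stays positive when \<open>C = 0\<close>, and the
        factor \<open>m + 1\<close> comes from
        \<open>m * k + 1 \<le> (m + 1) * (k + 1)\<close>.\<close>
      define D where "D = (C + 1) * real (m + 1)"
      have "D > 0" using \<open>0 \<le> C\<close> by (simp add: D_def)
      obtain k where k: "real (k + 1) * \<zeta> k < \<eta> 0 / D"
        using small[of "\<eta> 0 / D"] \<open>0 < \<eta> 0\<close> \<open>D > 0\<close> by auto
      have "\<eta> 0 / real (m * k + 1) \<le> C * \<zeta> k"
        using arith_mean_ge[of \<eta> "m * k"] \<eta>nn bound[of k] S(2) by simp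
      then have "\<eta> 0 \<le> C * \<zeta> k * real (m * k + 1)"
        by (subst (asm) pos_divide_le_eq, intro of_nat_0_less_iff[THEN iffD2]) simp_all
      also have "\<dots> \<le> (C + 1) * \<zeta> k * (real (m + 1) * real (k + 1))"
        using nn \<open>0 \<le> C\<close> by (intro mult_mono) (auto simp: algebra_simps)
      also have "\<dots> = D * (real (k + 1) * \<zeta> k)" by (simp add: D_def mult_ac)
      also have "\<dots> < \<eta> 0" using k \<open>D > 0\<close> by (simp add: pos_less_divide_eq mult_ac)
      finally show False by simp
    qed
    then have "\<eta> = (\<lambda>n. 0)"
      using c0_star_antimono[OF \<eta>, of 0] \<eta>nn by (metis le0 order_antisym)
    \<comment> \<open>Membership of the compact operator \<open>T\<close> is decided by its
      s-numbers alone, so it is enough to realise the zero mean by the zero operator, which lies in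
      \<open>I\<close>.\<close>
    then have "arith_mean \<eta> = s_numbers (\<lambda>x::'a. 0)"
      by (simp add: arith_mean_def s_numbers_zero fun_eq_iff)
    moreover have "(\<lambda>x. 0) \<in> I" using assms(4) by (simp add: op_ideal_def two_sided_ideal_def)
    ultimately show ?thesis
      using \<eta> \<open>T \<in> compact_ops\<close>
      by (auto simp: pre_arith_mean_def ideal_of_char_set_def char_set_def \<eta>_def)
  qed
  ultimately show ?thesis using \<zeta> by blast
qed

end
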